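(* Let $D$ be a distributive lattice isomorphic to $\mathcal{J}(P)$, where $P$ is a poset. Then Hibi's algebra $$\mathbf{k}[r_\alpha : \alpha\in D]\big/\langle r_\alpha r_\beta - r_{\alpha\vee\beta}\,r_{\alpha\wedge\beta} : \alpha,\beta\in D\rangle$$ is isomorphic to $R^{\mathtt{top}}_{B_P\to\Lambda}/I^{\mathtt{top}}_{B_P\to\Lambda}$.
   Context: $\mathbf{k}$ is a field. For a poset $P$, $\mathcal{J}(P)$ is the lattice of lower ideals of $P$ (subsets $L$ with $p\le q\in L\Rightarrow p\in L$) ordered by inclusion. $B_P$ is the bipartite graph with vertex set $P\times\{l,u\}$ and an edge between $(p,l)$ and $(q,u)$ whenever $p\ge q$ in $P$. Graphs are finite and undirected without multiple edges; loops are allowed in general. $\mathrm{Hom}(G,H)$ is the set of maps $\phi:V(G)\to V(H)$ with $\phi(u)\phi(v)\in E(H)$ whenever $uv\in E(G)$. For $e\in E(G)$ let $G[e]$ be the subgraph consisting only of $e$ and its endpoint(s). Put $R_{G\to H}=\mathbf{k}[r_\phi : \phi\in\mathrm{Hom}(G,H)]$, $S_{G\to H}=\mathbf{k}[s_\psi : e\in E(G),\ \psi\in \mathrm{Hom}(G[e],H)]$, let $\Phi_{G\to H}:R_{G\to H}\to S_{G\to H}$ be the $\mathbf{k}$-algebra map with $\Phi(r_\phi)=\prod_{e\in E(G)} s_{\phi|_e}$, and $I_{G\to H}=\ker\Phi_{G\to H}$. $\Lambda$ is the graph with two vertices joined by an edge and with a loop at exactly one of the two vertices. Elements of $\mathrm{Hom}(G,\Lambda)$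 correspond bijectively to independent sets $S$ of $G$ ($S$ is the preimage of the unlooped vertex), and the corresponding variable is $r_S$. Let $\alpha(G)$ be the size of a largest independent set of $G$. The top graded parts are $R^{\mathtt{top}}_{G\to\Lambda}=\mathbf{k}[r_S : S \text{ independent in } G,\ |S|=\alpha(G)]$ and $I^{\mathtt{top}}_{G\to\Lambda}=I_{G\to\Lambda}\cap R^{\mathtt{top}}_{G\to\Lambda}$.
   Formalization: The poset P is taken to be nonempty (and finite, as graphs are finite): for empty P the graph B_P has no edges, so the right-hand quotient is k, while Hibi's algebra of the one-element lattice is k[r]. *)

theory Defs
  imports
    "HOL-Algebra.QuotRing"
    "HOL-Library.Poly_Mapping"
    "HOL-Library.FuncSet"
begin

section \<open>Algebras over a field\<close>

text \<open>A commutative \<open>'k\<close>-algebra is a commutative ring together with its structure map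
  \<open>c \<mapsto> c \<cdot> 1\<close> from the coefficient field \<open>'k\<close>.\<close>

record ('k, 'a) k_algebra = "'a ring" +
  structure_map :: "'k \<Rightarrow> 'a"

definition quotient_algebra ::
  "('k, 'a) k_algebra \<Rightarrow> 'a set \<Rightarrow> ('k, 'a set) k_algebra"
  where "quotient_algebra A J =
    ring.extend (A Quot J) (k_algebra.fields (\<lambda>c. J +>\<^bsub>A\<^esub> structure_map A c))"

definition k_algebra_isomorphic ::
  "('k, 'a) k_algebra \<Rightarrow> ('k, 'b) k_algebra \<Rightarrow> bool"
  where "k_algebra_isomorphic A B \<longleftrightarrow>
    (\<exists>h \<in> ring_iso A B. \<forall>c. h (structure_map A c) = structure_map B c)"

section \<open>Polynomial algebras in an arbitrary set of variables\<close>

text \<open>A monomial is a finitely supported exponent function and a polynomial a finitely supported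
  coefficient function on monomials; the product of \<^theory>\<open>HOL-Library.Poly_Mapping\<close> is the
  convolution product.\<close>

type_synonym ('v, 'k) mpoly = "('v \<Rightarrow>\<^sub>0 nat) \<Rightarrow>\<^sub>0 'k"

definition pconst :: "'k \<Rightarrow> ('v, 'k::field) mpoly"
  where "pconst c = Poly_Mapping.single 0 c"

definition pvar :: "'v \<Rightarrow> ('v, 'k::field) mpoly"
  where "pvar v = Poly_Mapping.single (Poly_Mapping.single v 1) 1"

text \<open>The algebra \<open>k[x\<^sub>v : v \<in> V]\<close>. For \<open>W \<subseteq> V\<close>, the algebra on \<open>W\<close> is literally a
  subalgebra of the one on \<open>V\<close>.\<close>

definition poly_algebra :: "'v set \<Rightarrow> ('k::field, ('v, 'k) mpoly) k_algebra"
  where "poly_algebra V =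
    \<lparr>carrier = {p. \<forall>m \<in> Poly_Mapping.keys p. Poly_Mapping.keys m \<subseteq> V},
     monoid.mult = (*), one = 1, ring.zero = 0, add = (+), structure_map = pconst\<rparr>"

text \<open>The \<open>k\<close>-algebra map that sends the variable \<open>x\<^sub>v\<close> to \<open>g v\<close>.\<close>

definition poly_subst ::
  "('v \<Rightarrow> ('w, 'k::field) mpoly) \<Rightarrow> ('v, 'k) mpoly \<Rightarrow> ('w, 'k) mpoly"
  where "poly_subst g p =
    (\<Sum>m \<in> Poly_Mapping.keys p. pconst (Poly_Mapping.lookup p m) *
       (\<Prod>v \<in> Poly_Mapping.keys m. g v ^ Poly_Mapping.lookup m v))"

section \<open>Graphs and homomorphisms\<close>

text \<open>An edge between \<open>u\<close> and \<open>v\<close> is the set \<open>{u, v}\<close>, so a loop is a singleton.\<close>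

record 'v graph =
  verts :: "'v set"
  edges :: "'v set set"

text \<open>Maps on \<open>V(G)\<close> are extensional functions, so that distinct members of \<open>Hom(G,H)\<close>
  really are distinct maps on \<open>V(G)\<close>.\<close>

definition graph_hom :: "'v graph \<Rightarrow> 'w graph \<Rightarrow> ('v \<Rightarrow> 'w) set"
  where "graph_hom G H = {\<phi> \<in> verts G \<rightarrow>\<^sub>E verts H.
    \<forall>u \<in> verts G. \<forall>v \<in> verts G. {u, v} \<in> edges G \<longrightarrow> {\<phi> u, \<phi> v} \<in> edges H}"

definition edge_subgraph :: "'v set \<Rightarrow> 'v graph"
  where "edge_subgraph e = \<lparr>verts = e, edges = {e}\<rparr>"

definition independent_set :: "'v graph \<Rightarrow> 'v set \<Rightarrow> bool"
  where "independent_set G S \<longleftrightarrow>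
    S \<subseteq> verts G \<and> (\<forall>u \<in> S. \<forall>v \<in> S. {u, v} \<notin> edges G)"

definition independence_number :: "'v graph \<Rightarrow> nat"
  where "independence_number G = Max {card S | S. independent_set G S}"

section \<open>The toric ideals of graph homomorphisms\<close>

definition R_hom :: "'v graph \<Rightarrow> 'w graph \<Rightarrow> ('k::field, ('v \<Rightarrow> 'w, 'k) mpoly) k_algebra"
  where "R_hom G H = poly_algebra (graph_hom G H)"

definition S_hom ::
  "'v graph \<Rightarrow> 'w graph \<Rightarrow> ('k::field, ('v set \<times> ('v \<Rightarrow> 'w), 'k) mpoly) k_algebra"
  where "S_hom G H = poly_algebra (SIGMA e:edges G. graph_hom (edge_subgraph e) H)"

definition Phi_hom ::
  "'v graph \<Rightarrow> ('v \<Rightarrow> 'w, 'k::field) mpoly \<Rightarrow> ('v set \<times> ('v \<Rightarrow> 'w), 'k) mpoly"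
  where "Phi_hom G = poly_subst (\<lambda>\<phi>. \<Prod>e \<in> edges G. pvar (e, restrict \<phi> e))"

definition I_hom :: "'v graph \<Rightarrow> 'w graph \<Rightarrow> ('v \<Rightarrow> 'w, 'k::field) mpoly set"
  where "I_hom G H = a_kernel (R_hom G H) (S_hom G H) (Phi_hom G)"

section \<open>Independent sets and the top graded part\<close>

datatype lambda_vertex = Looped | Unlooped

definition Lambda :: "lambda_vertex graph"
  where "Lambda = \<lparr>verts = UNIV, edges = {{Looped, Unlooped}, {Looped}}\<rparr>"

text \<open>The homomorphism to \<open>\<Lambda>\<close> corresponding to an independent set.\<close>

definition hom_of_indep :: "'v graph \<Rightarrow> 'v set \<Rightarrow> 'v \<Rightarrow> lambda_vertex"
  where "hom_of_indep G S = (\<lambda>v \<in> verts G. if v \<in> S then Unlooped else Looped)"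

lemma bij_betw_hom_of_indep:
  "bij_betw (hom_of_indep G) {S. independent_set G S} (graph_hom G Lambda)"
proof (rule bij_betw_byWitness[where f' = "\<lambda>\<phi>. {v \<in> verts G. \<phi> v = Unlooped}"])
  show "\<forall>S \<in> {S. independent_set G S}. {v \<in> verts G. hom_of_indep G S v = Unlooped} = S"
    by (auto simp: independent_set_def hom_of_indep_def split: if_splits)
  show "\<forall>\<phi> \<in> graph_hom G Lambda. hom_of_indep G {v \<in> verts G. \<phi> v = Unlooped} = \<phi>"
  proof
    fix \<phi> assume "\<phi> \<in> graph_hom G Lambda"
    then have "\<phi> \<in> extensional (verts G)"
      by (auto simp: graph_hom_def PiE_def)
    then show "hom_of_indep G {v \<in> verts G. \<phi> v = Unlooped} = \<phi>"
      by (intro extensionalityI[of _ "verts G"])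
        (auto simp: hom_of_indep_def, metis lambda_vertex.exhaust)
  qed
  show "hom_of_indep G ` {S. independent_set G S} \<subseteq> graph_hom G Lambda"
    by (auto simp: graph_hom_def hom_of_indep_def Lambda_def independent_set_def insert_commute
        split: if_splits)
  show "(\<lambda>\<phi>. {v \<in> verts G. \<phi> v = Unlooped}) ` graph_hom G Lambda \<subseteq> {S. independent_set G S}"
    by (auto simp: graph_hom_def Lambda_def independent_set_def doubleton_eq_iff)
qed

definition R_top :: "'v graph \<Rightarrow> ('k::field, ('v \<Rightarrow> lambda_vertex, 'k) mpoly) k_algebra"
  where "R_top G = poly_algebra
    (hom_of_indep G ` {S. independent_set G S \<and> card S = independence_number G})"

definition I_top :: "'v graph \<Rightarrow> ('v \<Rightarrow> lambda_vertex, 'k::field) mpoly set"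
  where "I_top G = I_hom G Lambda \<inter> carrier (R_top G :: ('k, _) k_algebra)"

section \<open>Posets, lower ideals, and Hibi's algebra\<close>

text \<open>A finite poset is a type of class \<open>{finite, order}\<close>, so it is nonempty. The empty poset has
  to be excluded: its graph has no edges, hence \<open>I\<^sup>t\<^sup>o\<^sup>p\<close> is generated by \<open>r - 1\<close> and the quotient
  is \<open>k\<close>, whereas Hibi's algebra of the one-element lattice is \<open>k[r]\<close>.\<close>

definition lower_ideals :: "'p::order set set"
  where "lower_ideals = {L. \<forall>p q. p \<le> q \<longrightarrow> q \<in> L \<longrightarrow> p \<in> L}"

datatype side = Lower | Upper

definition poset_graph :: "('p::order \<times> side) graph"
  where "poset_graph = \<lparr>verts = UNIV, edges = {{(p, Lower), (q, Upper)} | p q. q \<le> p}\<rparr>"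

definition hibi_ideal :: "('d::distrib_lattice, 'k::field) mpoly set"
  where "hibi_ideal = Idl\<^bsub>poly_algebra UNIV :: ('k, ('d, 'k) mpoly) k_algebra\<^esub>
    {pvar a * pvar b - pvar (sup a b) * pvar (inf a b) | a b. True}"

definition hibi_algebra :: "('k::field, ('d::distrib_lattice, 'k) mpoly set) k_algebra"
  where "hibi_algebra = quotient_algebra (poly_algebra UNIV) hibi_ideal"

end

theory Submission
  imports Defs "HOL-Library.Multiset" "HOL-Library.Cardinality"
begin

text \<open>The pairs \<open>(p, l)\<close>, \<open>(p, u)\<close> form a perfect matching of \<open>B\<^sub>P\<close>, so a maximum independent set
  picks one vertex of each pair, and the picked \<open>p\<close> in the side \<open>l\<close> form a lower ideal. Under this
  identification the claim is that the Hibi relations generate the kernel of a map sending variables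
  to monomials. Such a kernel is spanned by binomials, and two monomials with the same image have the
  same degree and, for each \<open>p\<close>, the same number of variables whose lower ideal contains \<open>p\<close>; modulo
  the Hibi relations each of them equals the chain monomial determined by these numbers.\<close>

section \<open>Substitution in polynomials\<close>

lemma poly_mapping_eq_sum_single:
  "p = (\<Sum>m\<in>Poly_Mapping.keys p. Poly_Mapping.single m (Poly_Mapping.lookup p m))"
  by (rule poly_mapping_eqI)
    (auto simp: lookup_sum lookup_single when_def sum.delta in_keys_iff)

lemma pconst_zero [simp]: "pconst 0 = 0"
  and pconst_one [simp]: "pconst 1 = 1"
  and pconst_add: "pconst (a + b) = pconst a + pconst b"
  and pconst_mult: "pconst (a * b) = pconst a * pconst b"
  by (simp_all add: pconst_def single_add mult_single)

definition monomial_value ::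
  "('v \<Rightarrow> ('w, 'k::field) mpoly) \<Rightarrow> ('v \<Rightarrow>\<^sub>0 nat) \<Rightarrow> ('w, 'k) mpoly"
  where "monomial_value g m = (\<Prod>v\<in>Poly_Mapping.keys m. g v ^ Poly_Mapping.lookup m v)"

text \<open>Exponents 0 contribute factors 1, so several monomials can be compared over one common
  finite index set.\<close>

lemma monomial_value_superset:
  assumes "finite A" "Poly_Mapping.keys m \<subseteq> A"
  shows "monomial_value g m = (\<Prod>v\<in>A. g v ^ Poly_Mapping.lookup m v)"
  unfolding monomial_value_def
  by (rule prod.mono_neutral_left) (use assms in \<open>auto simp: in_keys_iff\<close>)

lemma monomial_value_zero [simp]: "monomial_value g 0 = 1"
  by (simp add: monomial_value_def)

lemma monomial_value_add:
  "monomial_value g (m + n) = monomial_value g m * monomial_value g n"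
proof -
  let ?A = "Poly_Mapping.keys m \<union> Poly_Mapping.keys n"
  have "Poly_Mapping.keys (m + n) \<subseteq> ?A"
    by (rule keys_add)
  then show ?thesis
    by (simp add: monomial_value_superset[of ?A] lookup_add power_add prod.distrib)
qed

text \<open>Cancellation may shrink the support of a sum; padding with zero coefficients to a common
  index set makes additivity a termwise computation.\<close>

lemma poly_subst_superset:
  assumes "finite A" "Poly_Mapping.keys p \<subseteq> A"
  shows "poly_subst g p = (\<Sum>m\<in>A. pconst (Poly_Mapping.lookup p m) * monomial_value g m)"
  unfolding poly_subst_def monomial_value_def[symmetric]
  by (rule sum.mono_neutral_left) (use assms in \<open>auto simp: in_keys_iff\<close>)

lemma poly_subst_zero [simp]: "poly_subst g 0 = 0"
  by (simp add: poly_subst_def)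

lemma poly_subst_single:
  "poly_subst g (Poly_Mapping.single m c) = pconst c * monomial_value g m"
  by (subst poly_subst_superset[of "{m}"]) auto

lemma poly_subst_pconst [simp]: "poly_subst g (pconst c) = pconst c"
  unfolding pconst_def[of c] poly_subst_single by (simp add: pconst_def)

lemma poly_subst_one [simp]: "poly_subst g 1 = 1"
  using poly_subst_pconst[of g 1] by simp

lemma poly_subst_pvar [simp]: "poly_subst g (pvar v) = g v"
  unfolding pvar_def poly_subst_single by (simp add: monomial_value_def)

lemma poly_subst_add: "poly_subst g (p + q) = poly_subst g p + poly_subst g q"
proof -
  let ?A = "Poly_Mapping.keys p \<union> Poly_Mapping.keys q"
  have "Poly_Mapping.keys (p + q) \<subseteq> ?A"
    by (rule keys_add)
  then show ?thesis
    by (simp add: poly_subst_superset[of ?A] lookup_add pconst_add distrib_right sum.distrib)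
qed

lemma poly_subst_uminus: "poly_subst g (- p) = - poly_subst g p"
  using poly_subst_add[of g p "- p"] by (simp add: eq_neg_iff_add_eq_0 add.commute)

lemma poly_subst_diff: "poly_subst g (p - q) = poly_subst g p - poly_subst g q"
  using poly_subst_add[of g p "- q"] by (simp add: poly_subst_uminus)

lemma poly_subst_sum: "poly_subst g (sum h A) = (\<Sum>i\<in>A. poly_subst g (h i))"
  by (induction A rule: infinite_finite_induct) (simp_all add: poly_subst_add)

text \<open>Both sides are biadditive in \<open>p\<close> and \<open>q\<close>, so only single terms
  matter, and there exponents add while values multiply.\<close>

lemma poly_subst_mult: "poly_subst g (p * q) = poly_subst g p * poly_subst g q"
proof -
  let ?P = "\<lambda>m. Poly_Mapping.single m (Poly_Mapping.lookup p m)"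
  let ?Q = "\<lambda>m. Poly_Mapping.single m (Poly_Mapping.lookup q m)"
  have "poly_subst g ((\<Sum>m\<in>Poly_Mapping.keys p. ?P m) * (\<Sum>n\<in>Poly_Mapping.keys q. ?Q n)) =
    poly_subst g (\<Sum>m\<in>Poly_Mapping.keys p. ?P m) * poly_subst g (\<Sum>n\<in>Poly_Mapping.keys q. ?Q n)"
    by (simp add: sum_product poly_subst_sum poly_subst_single mult_single pconst_mult
        monomial_value_add ac_simps)
  then show ?thesis
    by (simp flip: poly_mapping_eq_sum_single)
qed

lemma poly_subst_power: "poly_subst g (p ^ n) = poly_subst g p ^ n"
  by (induction n) (simp_all add: poly_subst_mult)

lemma poly_subst_prod: "poly_subst g (prod h A) = (\<Prod>i\<in>A. poly_subst g (h i))"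
  by (induction A rule: infinite_finite_induct) (simp_all add: poly_subst_mult)

lemma poly_subst_prod_mset:
  "poly_subst g (prod_mset M) = prod_mset (image_mset (poly_subst g) M)"
  by (induction M) (simp_all add: poly_subst_mult)

text \<open>Lets the toric map after a renaming of variables be treated as one substitution.\<close>

lemma poly_subst_poly_subst:
  "poly_subst g (poly_subst h p) = poly_subst (\<lambda>v. poly_subst g (h v)) p"
  unfolding poly_subst_def[of h] poly_subst_def[of "\<lambda>v. poly_subst g (h v)"]
  by (simp add: poly_subst_sum poly_subst_mult poly_subst_prod poly_subst_power)

lemma poly_subst_cong:
  assumes "\<And>m v. m \<in> Poly_Mapping.keys p \<Longrightarrow> v \<in> Poly_Mapping.keys m \<Longrightarrow> g v = h v"
  shows "poly_subst g p = poly_subst h p"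
  unfolding poly_subst_def using assms by (intro sum.cong prod.cong) auto

text \<open>Multisets replace exponent functions because the reduction modulo the Hibi relations
  adds and removes variables one at a time.\<close>

definition monic_monomial :: "'v multiset \<Rightarrow> ('v, 'k::field) mpoly"
  where "monic_monomial M = prod_mset (image_mset pvar M)"

lemma prod_single:
  "(\<Prod>i\<in>A. Poly_Mapping.single (e i) (1::'a::comm_semiring_1)) =
    Poly_Mapping.single (\<Sum>i\<in>A. e i :: 'b::comm_monoid_add) 1"
  by (induction A rule: infinite_finite_induct) (simp_all add: mult_single)

lemma prod_mset_single:
  "(\<Prod>a\<in>#M. Poly_Mapping.single (e a) (1::'a::comm_semiring_1)) =
    Poly_Mapping.single (\<Sum>a\<in>#M. e a :: 'b::comm_monoid_add) 1"
  by (induction M) (simp_all add: mult_single)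

lemma pvar_power:
  "pvar v ^ n = Poly_Mapping.single (Poly_Mapping.single v n) 1"
  by (induction n) (simp_all add: pvar_def mult_single flip: single_add)

lemma single_eq_monomial_value:
  "Poly_Mapping.single m 1 = (monomial_value pvar m :: ('v, 'k::field) mpoly)"
  by (simp add: monomial_value_def pvar_power prod_single flip: poly_mapping_eq_sum_single)

lemma poly_subst_pvar_ident [simp]: "poly_subst pvar p = p"
proof -
  have "poly_subst pvar p =
    (\<Sum>m\<in>Poly_Mapping.keys p. Poly_Mapping.single m (Poly_Mapping.lookup p m))"
    by (simp add: poly_subst_def pconst_def mult_single
        flip: monomial_value_def single_eq_monomial_value)
  then show ?thesis
    by (simp flip: poly_mapping_eq_sum_single)
qed

lemma single_eq_monic_monomial:
  "\<exists>M. Poly_Mapping.single m 1 = (monic_monomial M :: ('v, 'k::field) mpoly)"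
proof
  have prod: "prod_mset (image_mset pvar (\<Sum>v\<in>A. F v)) =
    (\<Prod>v\<in>A. prod_mset (image_mset pvar (F v)) :: ('v, 'k::field) mpoly)"
    for A :: "'v set" and F :: "'v \<Rightarrow> 'v multiset"
    by (induction A rule: infinite_finite_induct) simp_all
  show "Poly_Mapping.single m 1 =
    (monic_monomial (\<Sum>v\<in>Poly_Mapping.keys m. replicate_mset (Poly_Mapping.lookup m v) v)
      :: ('v, 'k) mpoly)"
    by (simp add: single_eq_monomial_value monomial_value_def monic_monomial_def prod)
qed

section \<open>Ideals of polynomial algebras\<close>

lemma poly_algebra_simps [simp]:
  "carrier (poly_algebra V) = {p. \<forall>m \<in> Poly_Mapping.keys p. Poly_Mapping.keys m \<subseteq> V}"
  "p \<otimes>\<^bsub>poly_algebra V\<^esub> q = p * q" "\<one>\<^bsub>poly_algebra V\<^esub> = 1"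
  "p \<oplus>\<^bsub>poly_algebra V\<^esub> q = p + q" "\<zero>\<^bsub>poly_algebra V\<^esub> = 0"
  "structure_map (poly_algebra V) = pconst"
  by (simp_all add: poly_algebra_def)

lemma cring_poly_algebra: "cring (poly_algebra V :: ('k::field, ('v, 'k) mpoly) k_algebra)"
proof -
  let ?R = "poly_algebra V :: ('k, ('v, 'k) mpoly) k_algebra"
  have mult: "p * q \<in> carrier ?R" if p: "p \<in> carrier ?R" and q: "q \<in> carrier ?R" for p q
  proof -
    have "Poly_Mapping.keys m \<subseteq> V" if m: "m \<in> Poly_Mapping.keys (p * q)" for m
    proof -
      obtain a b where ab: "m = a + b" "a \<in> Poly_Mapping.keys p" "b \<in> Poly_Mapping.keys q"
        using m keys_mult[of p q] by blast
      then have "Poly_Mapping.keys a \<subseteq> V" "Poly_Mapping.keys b \<subseteq> V"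
        using p q by auto
      then show ?thesis
        using keys_add[of a b] ab(1) by blast
    qed
    then show ?thesis
      by simp
  qed
  have add: "p + q \<in> carrier ?R" if p: "p \<in> carrier ?R" and q: "q \<in> carrier ?R" for p q
  proof -
    have "Poly_Mapping.keys m \<subseteq> V" if m: "m \<in> Poly_Mapping.keys (p + q)" for m
      using m p q keys_add[of p q] by auto
    then show ?thesis
      by simp
  qed
  show ?thesis
  proof (rule cringI)
    show "abelian_group ?R"
    proof (rule abelian_groupI)
      show "\<exists>y\<in>carrier ?R. y \<oplus>\<^bsub>?R\<^esub> x = \<zero>\<^bsub>?R\<^esub>" if "x \<in> carrier ?R" for x
        using that by (intro bexI[of _ "- x"]) auto
    qed (use add in \<open>simp_all add: add.assoc add.commute del: poly_algebra_simps(1)\<close>, simp)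
    show "comm_monoid ?R"
      by (rule comm_monoidI) (use mult in \<open>simp_all add: mult.assoc mult.commute del: poly_algebra_simps(1)\<close>, simp)
  qed (auto simp: distrib_right)
qed

lemma ring_poly_algebra: "ring (poly_algebra V :: ('k::field, ('v, 'k) mpoly) k_algebra)"
  using cring_poly_algebra by (rule cring.axioms)

lemma pconst_carrier: "pconst c \<in> carrier (poly_algebra V)"
  by (simp add: pconst_def)

lemma pvar_carrier_iff: "pvar v \<in> carrier (poly_algebra V) \<longleftrightarrow> v \<in> V"
  by (simp add: pvar_def)

lemma prod_carrier:
  assumes "\<And>i. i \<in> A \<Longrightarrow> h i \<in> carrier (poly_algebra V)"
  shows "prod h A \<in> carrier (poly_algebra V :: ('k::field, ('v, 'k) mpoly) k_algebra)"
proof -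
  interpret cring "poly_algebra V :: ('k, ('v, 'k) mpoly) k_algebra"
    by (rule cring_poly_algebra)
  show ?thesis
    using assms
  proof (induction A rule: infinite_finite_induct)
    case (insert x F)
    then show ?case
      using m_closed[of "h x" "prod h F"] by (simp del: poly_algebra_simps(1))
  qed (use one_closed in \<open>simp_all del: poly_algebra_simps(1)\<close>)
qed

lemma poly_subst_carrier:
  assumes "\<And>v. v \<in> V \<Longrightarrow> g v \<in> carrier (poly_algebra W)" "p \<in> carrier (poly_algebra V)"
  shows "poly_subst g p \<in> carrier (poly_algebra W :: ('k::field, ('w, 'k) mpoly) k_algebra)"
proof -
  interpret cring "poly_algebra W :: ('k, ('w, 'k) mpoly) k_algebra"
    by (rule cring_poly_algebra)
  have mult: "p * q \<in> carrier (poly_algebra W)"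
    if "p \<in> carrier (poly_algebra W)" "q \<in> carrier (poly_algebra W)"
    for p q :: "('w, 'k) mpoly"
    using m_closed[OF that] by (simp del: poly_algebra_simps(1))
  have sum: "sum h A \<in> carrier (poly_algebra W)"
    if "\<And>i. i \<in> A \<Longrightarrow> h i \<in> carrier (poly_algebra W)"
    for A and h :: "('v \<Rightarrow>\<^sub>0 nat) \<Rightarrow> ('w, 'k) mpoly"
    using that
  proof (induction A rule: infinite_finite_induct)
    case (insert x F)
    then show ?case
      using a_closed[of "h x" "sum h F"] by (simp del: poly_algebra_simps(1))
  qed (use zero_closed in \<open>simp_all del: poly_algebra_simps(1)\<close>)
  have power: "q ^ n \<in> carrier (poly_algebra W)" if "q \<in> carrier (poly_algebra W)"
    for q :: "('w, 'k) mpoly" and n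
    using prod_carrier[of "{..<n}" "\<lambda>_. q"] that by (simp del: poly_algebra_simps(1))
  show ?thesis
    unfolding poly_subst_def
  proof (intro sum mult prod_carrier pconst_carrier power)
    fix m v
    assume "m \<in> Poly_Mapping.keys p" "v \<in> Poly_Mapping.keys m"
    then show "g v \<in> carrier (poly_algebra W)"
      using assms by auto
  qed
qed

lemma poly_subst_ring_hom:
  assumes "\<And>v. v \<in> V \<Longrightarrow> g v \<in> carrier (poly_algebra W)"
  shows "ring_hom_ring (poly_algebra V) (poly_algebra W) (poly_subst g)"
proof (rule ring_hom_ringI[OF ring_poly_algebra ring_poly_algebra])
  show "poly_subst g p \<in> carrier (poly_algebra W)" if "p \<in> carrier (poly_algebra V)" for p
    using assms that by (rule poly_subst_carrier)
qed (simp_all add: poly_subst_add poly_subst_mult)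

context
  fixes V :: "'v set" and I :: "('v, 'k::field) mpoly set"
  assumes ideal: "ideal I (poly_algebra V)"
begin

lemma poly_ideal_zero: "0 \<in> I"
  using additive_subgroup.zero_closed[OF ideal.axioms(1)[OF ideal]] by simp

lemma poly_ideal_add: "p \<in> I \<Longrightarrow> q \<in> I \<Longrightarrow> p + q \<in> I"
  using additive_subgroup.a_closed[OF ideal.axioms(1)[OF ideal]] by fastforce

lemma poly_ideal_mult: "p \<in> I \<Longrightarrow> c \<in> carrier (poly_algebra V) \<Longrightarrow> c * p \<in> I"
  using ideal.I_l_closed[OF ideal] by fastforce

lemma poly_ideal_diff:
  assumes "p \<in> I" "q \<in> I"
  shows "p - q \<in> I"
proof -
  have "- 1 * q \<in> I"
    by (rule poly_ideal_mult) (use assms in simp_all)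
  then show ?thesis
    using poly_ideal_add[OF assms(1)] by fastforce
qed

lemma poly_ideal_sum: "(\<And>i. i \<in> A \<Longrightarrow> h i \<in> I) \<Longrightarrow> sum h A \<in> I"
  by (induction A rule: infinite_finite_induct) (auto simp: poly_ideal_zero poly_ideal_add)

end

text \<open>The kernel of a map sending variables to monomials is spanned by binomials: replacing each
  monomial of \<open>p\<close> by a fixed representative of its fibre changes \<open>p\<close> only by binomials of the
  kernel, and turns the coefficients into the fibre sums, which are the coefficients of the image.\<close>

lemma monomial_map_kernel_subset:
  fixes e :: "'v \<Rightarrow> 'w \<Rightarrow>\<^sub>0 nat" and I :: "('v, 'k::field) mpoly set"
  assumes ideal: "ideal I (poly_algebra UNIV)"
    and binomial: "\<And>M N. (\<Sum>a\<in>#M. e a) = (\<Sum>a\<in>#N. e a) \<Longrightarrow>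
      monic_monomial M - monic_monomial N \<in> I"
    and p: "poly_subst (\<lambda>a. Poly_Mapping.single (e a) 1) p = 0"
  shows "p \<in> I"
proof -
  let ?single = "\<lambda>m c. Poly_Mapping.single m c :: ('v, 'k) mpoly"
  let ?K = "Poly_Mapping.keys p"
  let ?c = "Poly_Mapping.lookup p"
  obtain mset where mset: "?single m 1 = monic_monomial (mset m)" for m
    using single_eq_monic_monomial by metis
  define E where "E m = (\<Sum>a\<in>#mset m. e a)" for m
  \<comment> \<open>Outside the range of \<open>E\<close> the choice is arbitrary, but
    \<open>rep\<close> is only applied to values of \<open>E\<close>.\<close>
  define rep where "rep \<mu> = (SOME m. E m = \<mu>)" for \<mu>
  have E_rep: "E (rep (E m)) = E m" for m
    unfolding rep_def by (rule someI) simp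
  have image: "poly_subst (\<lambda>a. Poly_Mapping.single (e a) 1) (?single m c) =
    Poly_Mapping.single (E m) c" for m c
  proof -
    have "?single m c = pconst c * monic_monomial (mset m)"
      by (simp add: pconst_def mult_single flip: mset)
    then show ?thesis
      by (simp add: poly_subst_mult monic_monomial_def poly_subst_prod_mset
          image_mset.compositionality o_def prod_mset_single E_def)
        (simp add: pconst_def mult_single)
  qed
  have image_p: "(\<Sum>m\<in>?K. Poly_Mapping.single (E m) (?c m)) = 0"
    using p by (subst (asm) poly_mapping_eq_sum_single) (simp add: poly_subst_sum image)
  \<comment> \<open>The coefficient of the image at \<open>\<mu>\<close> collects exactly the terms
    of \<open>p\<close> whose monomials lie in the fibre over \<open>\<mu>\<close>.\<close>
  have fibre: "(\<Sum>m\<in>{m\<in>?K. E m = \<mu>}. ?c m) = 0" for \<mu>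
    using arg_cong[OF image_p, of "\<lambda>q. Poly_Mapping.lookup q \<mu>"]
    by (simp add: lookup_sum lookup_single when_def sum.If_cases Int_def)
  have sum_single: "(\<Sum>m\<in>A. ?single r (?c m)) = ?single r (\<Sum>m\<in>A. ?c m)" for r A
    by (induction A rule: infinite_finite_induct) (simp_all add: single_add)
  have "(\<Sum>m\<in>?K. ?single (rep (E m)) (?c m)) =
    (\<Sum>\<mu>\<in>E ` ?K. \<Sum>m\<in>{m\<in>?K. E m = \<mu>}. ?single (rep (E m)) (?c m))"
    by (rule sum.image_gen) simp
  also have "\<dots> = (\<Sum>\<mu>\<in>E ` ?K. \<Sum>m\<in>{m\<in>?K. E m = \<mu>}. ?single (rep \<mu>) (?c m))"
    by (intro sum.cong) auto
  also have "\<dots> = 0"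
    by (simp add: sum_single fibre)
  finally have reps: "(\<Sum>m\<in>?K. ?single (rep (E m)) (?c m)) = 0" .
  \<comment> \<open>This combination of binomials is \<open>p\<close> minus its sum over
    representatives, hence \<open>p\<close> itself by \<open>reps\<close>.\<close>
  have "(\<Sum>m\<in>?K. pconst (?c m) * (?single m 1 - ?single (rep (E m)) 1)) \<in> I"
  proof (intro poly_ideal_sum[OF ideal] poly_ideal_mult[OF ideal] pconst_carrier)
    show "?single m 1 - ?single (rep (E m)) 1 \<in> I" for m
      unfolding mset by (rule binomial) (use E_rep[of m] in \<open>simp add: E_def\<close>)
  qed
  also have "(\<Sum>m\<in>?K. pconst (?c m) * (?single m 1 - ?single (rep (E m)) 1)) =
    (\<Sum>m\<in>?K. ?single m (?c m)) - (\<Sum>m\<in>?K. ?single (rep (E m)) (?c m))"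
    by (simp add: pconst_def right_diff_distrib mult_single sum_subtractf)
  finally show ?thesis
    by (simp add: reps flip: poly_mapping_eq_sum_single)
qed

section \<open>Maximum independent sets of \<open>B\<^sub>P\<close>\<close>

definition indep_of_ideal :: "'p set \<Rightarrow> ('p \<times> side) set"
  where "indep_of_ideal L = {(p, s). p \<in> L \<longleftrightarrow> s = Lower}"

lemma poset_graph_edge_iff:
  "{(p, s), (q, t)} \<in> edges poset_graph \<longleftrightarrow>
    s = Lower \<and> t = Upper \<and> q \<le> p \<or> s = Upper \<and> t = Lower \<and> p \<le> q"
  by (auto simp: poset_graph_def doubleton_eq_iff)

lemma finite_edges_poset_graph: "finite (edges (poset_graph :: ('p::{finite, order} \<times> side) graph))"
proof (rule finite_subset)
  show "edges poset_graph \<subseteq> (\<lambda>(p, q). {(p, Lower), (q, Upper)}) ` (UNIV :: ('p \<times> 'p) set)"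
    by (auto simp: poset_graph_def)
qed simp

text \<open>An edge inside the set would join the lower copy of some p in \<open>L\<close> to the
  upper copy of some q outside \<open>L\<close> with q \<le> p, against downward closure.\<close>

lemma independent_indep_of_ideal:
  "L \<in> lower_ideals \<Longrightarrow> independent_set poset_graph (indep_of_ideal L)"
  by (auto simp: independent_set_def poset_graph_edge_iff indep_of_ideal_def lower_ideals_def)
    (auto simp: poset_graph_def)

lemma card_indep_of_ideal: "card (indep_of_ideal (L :: 'p::finite set)) = CARD('p)"
proof (rule bij_betw_same_card[of fst], rule bij_betw_byWitness)
  let ?g = "\<lambda>p. (p, if p \<in> L then Lower else Upper)"
  show "\<forall>x\<in>indep_of_ideal L. ?g (fst x) = x"
    by (auto simp: indep_of_ideal_def) (metis side.exhaust)
qed (auto simp: indep_of_ideal_def split: if_splits)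

text \<open>Two vertices over the same p would be the two ends of a matching edge, which is present
  by reflexivity of the order. This bounds the size of an independent set by the size of the
  poset.\<close>

lemma inj_on_fst_independent:
  assumes "independent_set poset_graph S"
  shows "inj_on fst S"
proof (rule inj_onI)
  fix x y assume xy: "x \<in> S" "y \<in> S" "fst x = fst y"
  then have "{x, y} \<notin> edges poset_graph"
    using assms by (auto simp: independent_set_def)
  then show "x = y"
    using xy(3) by (cases x; cases y; cases "snd x"; cases "snd y")
      (auto simp: poset_graph_edge_iff)
qed

lemma independence_number_poset_graph:
  "independence_number (poset_graph :: ('p::{finite, order} \<times> side) graph) = CARD('p)"
  unfolding independence_number_def
proof (rule Max_eqI)
  let ?C = "{card S | S. independent_set (poset_graph :: ('p \<times> side) graph) S}"
  show bound: "c \<le> CARD('p)" if "c \<in> ?C" for c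
    using that inj_on_fst_independent card_inj_on_le[of fst _ UNIV] by fastforce
  show "finite ?C"
    using bound by (meson finite_nat_set_iff_bounded_le)
  \<comment> \<open>The whole poset is taken as a lower ideal to attain the bound; its independent
    set consists of all lower copies.\<close>
  have "UNIV \<in> lower_ideals"
    by (simp add: lower_ideals_def)
  then show "CARD('p) \<in> ?C"
    using independent_indep_of_ideal card_indep_of_ideal by (metis (mono_tags, lifting) mem_Collect_eq)
qed

text \<open>Equality in the bound makes \<open>fst\<close> a bijection from the independent set to
  the poset, so exactly one end of each matching edge is chosen. Independence along the remaining
  edges then says that the chosen lower copies form a lower ideal.\<close>

lemma maximum_independent_sets_poset_graph:
  "{S. independent_set (poset_graph :: ('p::{finite, order} \<times> side) graph) S \<and>
      card S = independence_number (poset_graph :: ('p \<times> side) graph)} =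
    indep_of_ideal ` lower_ideals"
proof (intro equalityI subsetI)
  fix S :: "('p \<times> side) set"
  assume "S \<in> {S. independent_set poset_graph S \<and>
    card S = independence_number (poset_graph :: ('p \<times> side) graph)}"
  then have S: "independent_set poset_graph S" and card: "card S = CARD('p)"
    by (auto simp: independence_number_poset_graph)
  have "card (fst ` S) = CARD('p)"
    using card card_image[OF inj_on_fst_independent[OF S]] by simp
  then have fst_S: "fst ` S = UNIV"
    by (metis card_eq_UNIV_imp_eq_UNIV finite)
  have edge: "{x, y} \<notin> edges poset_graph" if "x \<in> S" "y \<in> S" for x y
    using S that by (auto simp: independent_set_def)
  define L where "L = {p. (p, Lower) \<in> S}"
  have Upper: "(p, Upper) \<in> S" if "p \<notin> L" for p
  proof -
    obtain s where s: "(p, s) \<in> S"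
      using fst_S by (metis UNIV_I imageE prod.collapse)
    then show ?thesis
      using that by (cases s) (auto simp: L_def)
  qed
  have "S = indep_of_ideal L"
  proof (rule Set.set_eqI)
    fix x
    show "x \<in> S \<longleftrightarrow> x \<in> indep_of_ideal L"
      using edge[of "(fst x, Lower)" "(fst x, Upper)"] Upper[of "fst x"]
      by (cases x; cases "snd x") (auto simp: indep_of_ideal_def poset_graph_edge_iff L_def)
  qed
  moreover have "L \<in> lower_ideals"
    unfolding lower_ideals_def
  proof safe
    fix p q assume "p \<le> q" "q \<in> L"
    then show "p \<in> L"
      using edge[of "(q, Lower)" "(p, Upper)"] Upper[of p]
      by (auto simp: poset_graph_edge_iff L_def)
  qed
  ultimately show "S \<in> indep_of_ideal ` lower_ideals"
    by blast
next
  fix S :: "('p \<times> side) set"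
  assume "S \<in> indep_of_ideal ` lower_ideals"
  then show "S \<in> {S. independent_set poset_graph S \<and>
    card S = independence_number (poset_graph :: ('p \<times> side) graph)}"
    by (auto simp: independent_indep_of_ideal card_indep_of_ideal independence_number_poset_graph)
qed

section \<open>Hibi's ideal as a toric ideal\<close>

lemma ideal_hibi_ideal: "ideal hibi_ideal (poly_algebra UNIV)"
  unfolding hibi_ideal_def by (rule ring.genideal_ideal[OF ring_poly_algebra]) simp

lemma hibi_relation: "pvar a * pvar b - pvar (sup a b) * pvar (inf a b) \<in> hibi_ideal"
  unfolding hibi_ideal_def
  by (rule subsetD[OF ring.genideal_self[OF ring_poly_algebra]]) auto

text \<open>The isomorphism is one of ordered sets; that joins and meets become unions and
  intersections is derived from it below.\<close>

locale lower_ideal_lattice =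
  fixes f :: "'d::distrib_lattice \<Rightarrow> 'p::{finite, order} set"
  assumes bij: "bij_betw f UNIV lower_ideals"
    and le_iff: "\<And>a b. a \<le> b \<longleftrightarrow> f a \<subseteq> f b"
begin

lemma inj: "inj f" and range: "range f = lower_ideals"
  using bij by (simp_all add: bij_betw_def)

lemma lower: "q \<le> p \<Longrightarrow> p \<in> f a \<Longrightarrow> q \<in> f a"
  using range by (auto simp: lower_ideals_def)

text \<open>The union is a lower ideal, hence the image of some \<open>c\<close> by surjectivity.
  This \<open>c\<close> is an upper bound of \<open>a\<close> and \<open>b\<close>, so it lies above
  their join. The case of meets is dual.\<close>

lemma f_sup: "f (sup a b) = f a \<union> f b"
proof
  have "f a \<union> f b \<in> lower_ideals"
    using lower by (auto simp: lower_ideals_def)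
  then obtain c where c: "f c = f a \<union> f b"
    using range by (metis imageE)
  then have "a \<le> c" "b \<le> c"
    by (simp_all add: le_iff)
  then have "sup a b \<le> c"
    by simp
  then show "f (sup a b) \<subseteq> f a \<union> f b"
    by (metis c le_iff)
qed (simp flip: le_iff)

lemma f_inf: "f (inf a b) = f a \<inter> f b"
proof
  have "f a \<inter> f b \<in> lower_ideals"
    using lower by (auto simp: lower_ideals_def)
  then obtain c where c: "f c = f a \<inter> f b"
    using range by (metis imageE)
  then have "c \<le> a" "c \<le> b"
    by (simp_all add: le_iff)
  then have "c \<le> inf a b"
    by simp
  then show "f a \<inter> f b \<subseteq> f (inf a b)"
    by (metis c le_iff)
qed (simp flip: le_iff)

section \<open>Normal form of monomials modulo the Hibi relations\<close>

definition multiplicity_at :: "'p \<Rightarrow> 'd multiset \<Rightarrow> nat"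
  where "multiplicity_at p M = size {#a \<in># M. p \<in> f a#}"

lemma multiplicity_at_simps [simp]:
  "multiplicity_at p {#} = 0"
  "multiplicity_at p (add_mset a M) = of_bool (p \<in> f a) + multiplicity_at p M"
  by (simp_all add: multiplicity_at_def)

text \<open>Modulo the Hibi relations a monomial can be rewritten so that it contains the join of all its
  variables. This join and the multiplicities of the remaining factor are determined by the
  multiplicities of the monomial, so iterating gives a normal form.\<close>

lemma split_off_join:
  assumes "M \<noteq> {#}"
  shows "\<exists>s N. (monic_monomial M - monic_monomial (add_mset s N) :: ('d, 'k::field) mpoly)
      \<in> hibi_ideal \<and> size M = size (add_mset s N) \<and>
    (\<forall>p. multiplicity_at p M = multiplicity_at p (add_mset s N)) \<and>
    f s = {p. multiplicity_at p M > 0}"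
  using assms
proof (induction M)
  case (add a M)
  show ?case
  proof (cases "M = {#}")
    case True
    then show ?thesis
      by (intro exI[of _ a] exI[of _ "{#}"])
        (auto simp: poly_ideal_zero[OF ideal_hibi_ideal])
  next
    case False
    then obtain s N where
      diff: "(monic_monomial M - monic_monomial (add_mset s N) :: ('d, 'k) mpoly) \<in> hibi_ideal"
      and size: "size M = size (add_mset s N)"
      and mult: "\<And>p. multiplicity_at p M = multiplicity_at p (add_mset s N)"
      and join: "f s = {p. multiplicity_at p M > 0}"
      using add.IH by blast
    \<comment> \<open>The Hibi relation for \<open>a\<close> and the old join \<open>s\<close> moves
      their join to the front and their meet into the remainder. A union and an intersection
      together contain each p as often as the two original sets do, so multiplicities are
      kept.\<close>
    let ?N = "add_mset (inf a s) N"
    have "(monic_monomial (add_mset a M) - monic_monomial (add_mset (sup a s) ?N) :: ('d, 'k) mpoly)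
      = pvar a * (monic_monomial M - monic_monomial (add_mset s N)) +
        monic_monomial N * (pvar a * pvar s - pvar (sup a s) * pvar (inf a s))"
      by (simp add: monic_monomial_def algebra_simps)
    also have "\<dots> \<in> hibi_ideal"
      by (intro poly_ideal_add[OF ideal_hibi_ideal] poly_ideal_mult[OF ideal_hibi_ideal]
          diff hibi_relation) simp_all
    finally show ?thesis
      using size mult join
      by (intro exI[of _ "sup a s"] exI[of _ ?N]) (auto simp: f_sup f_inf)
  qed
qed simp

text \<open>Induction on the degree: the joins split off from both monomials coincide, since each
  consists of the p of positive multiplicity, and removing this common factor leaves equal data. The
  size records the occurrences of the bottom element, whose empty ideal adds to no
  multiplicity.\<close>

lemma monomial_diff_in_hibi_ideal:
  assumes "size M = size N" "\<And>p. multiplicity_at p M = multiplicity_at p N"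
  shows "(monic_monomial M - monic_monomial N :: ('d, 'k::field) mpoly) \<in> hibi_ideal"
  using assms
proof (induction "size M" arbitrary: M N)
  case 0
  then show ?case
    by (simp add: poly_ideal_zero[OF ideal_hibi_ideal])
next
  case (Suc n)
  let ?X = "monic_monomial :: 'd multiset \<Rightarrow> ('d, 'k) mpoly"
  have ne: "M \<noteq> {#}" "N \<noteq> {#}"
    using Suc.hyps(2) Suc.prems(1) by auto
  obtain s M' where M': "?X M - ?X (add_mset s M') \<in> hibi_ideal" "size M = size (add_mset s M')"
    "\<And>p. multiplicity_at p M = multiplicity_at p (add_mset s M')"
    "f s = {p. multiplicity_at p M > 0}"
    using split_off_join[OF ne(1)] by blast
  obtain t N' where N': "?X N - ?X (add_mset t N') \<in> hibi_ideal" "size N = size (add_mset t N')"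
    "\<And>p. multiplicity_at p N = multiplicity_at p (add_mset t N')"
    "f t = {p. multiplicity_at p N > 0}"
    using split_off_join[OF ne(2)] by blast
  have "s = t"
    using M'(4) N'(4) Suc.prems(2) by (intro injD[OF inj]) simp
  have "?X M' - ?X N' \<in> hibi_ideal"
  proof (rule Suc.hyps(1))
    show "n = size M'" "size M' = size N'"
      using Suc.hyps(2) Suc.prems(1) M'(2) N'(2) by simp_all
    show "multiplicity_at p M' = multiplicity_at p N'" for p
      using Suc.prems(2)[of p] M'(3)[of p] N'(3)[of p] \<open>s = t\<close> by simp
  qed
  \<comment> \<open>With \<open>s = t\<close> the terms containing \<open>M'\<close> and
    \<open>N'\<close> cancel, leaving the desired difference.\<close>
  then have "(?X M - ?X (add_mset s M')) - (?X N - ?X (add_mset t N')) + pvar s * (?X M' - ?X N')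
    \<in> hibi_ideal"
    by (intro poly_ideal_add[OF ideal_hibi_ideal] poly_ideal_diff[OF ideal_hibi_ideal M'(1) N'(1)]
        poly_ideal_mult[OF ideal_hibi_ideal]) simp_all
  then show ?case
    using \<open>s = t\<close> by (simp add: monic_monomial_def algebra_simps)
qed

section \<open>The toric map on the variables of the top part\<close>

definition hom_of :: "'d \<Rightarrow> 'p \<times> side \<Rightarrow> lambda_vertex"
  where "hom_of a = hom_of_indep poset_graph (indep_of_ideal (f a))"

lemma hom_of_eq: "hom_of a (p, s) = (if p \<in> f a \<longleftrightarrow> s = Lower then Unlooped else Looped)"
  by (simp add: hom_of_def hom_of_indep_def indep_of_ideal_def poset_graph_def)

lemma R_top_poset_graph:
  "(R_top poset_graph :: ('k::field, ('p \<times> side \<Rightarrow> lambda_vertex, 'k) mpoly) k_algebra) =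
    poly_algebra (range hom_of)"
proof -
  have "range hom_of = hom_of_indep poset_graph ` indep_of_ideal ` lower_ideals"
    by (auto simp: hom_of_def simp flip: range)
  then show ?thesis
    by (simp add: R_top_def maximum_independent_sets_poset_graph)
qed

text \<open>The exponent vector of the image of a variable, so that equality of images of monomials
  becomes equality of sums of vectors.\<close>

definition exponent :: "'d \<Rightarrow> ('p \<times> side) set \<times> ('p \<times> side \<Rightarrow> lambda_vertex) \<Rightarrow>\<^sub>0 nat"
  where "exponent a =
    (\<Sum>e\<in>edges poset_graph. Poly_Mapping.single (e, restrict (hom_of a) e) 1)"

lemma Phi_hom_pvar:
  "Phi_hom poset_graph (pvar (hom_of a)) = Poly_Mapping.single (exponent a) 1"
  by (simp add: Phi_hom_def pvar_def[of "(_, _)"] prod_single exponent_def)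

lemma lookup_exponent:
  assumes "e \<in> edges poset_graph"
  shows "Poly_Mapping.lookup (exponent a) (e, \<psi>) = of_bool (restrict (hom_of a) e = \<psi>)"
proof -
  have "Poly_Mapping.lookup (exponent a) (e, \<psi>) =
    (\<Sum>e'\<in>edges poset_graph. if e' = e then of_bool (restrict (hom_of a) e = \<psi>) else 0)"
    unfolding exponent_def lookup_sum lookup_single
    by (intro sum.cong) (auto simp: when_def)
  then show ?thesis
    using assms by (simp add: finite_edges_poset_graph)
qed

lemma lookup_exponent_sum:
  assumes "e \<in> edges poset_graph"
  shows "Poly_Mapping.lookup (\<Sum>a\<in>#M. exponent a) (e, \<psi>) =
    size {#a \<in># M. restrict (hom_of a) e = \<psi>#}"
  by (induction M) (simp_all add: lookup_add lookup_exponent assms del: restrict_apply)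

text \<open>The edges \<open>{(p, l), (p, u)}\<close> already reveal the degree and all multiplicities. Reading off
  the degree needs one such edge, that is, a nonempty poset.\<close>

lemma size_multiplicity_at_of_exponent:
  assumes "(\<Sum>a\<in>#M. exponent a) = (\<Sum>a\<in>#N. exponent a)"
  shows "size M = size N" and "multiplicity_at p M = multiplicity_at p N"
proof -
  define e where "e p = {(p, Lower), (p, Upper)}" for p :: 'p
  \<comment> \<open>The two restrictions that occur on the matching edge over p; \<open>c\<close>
    tells whether p belongs to the ideal.\<close>
  define \<psi> where "\<psi> p c = (\<lambda>(q, s)\<in>e p. if c \<longleftrightarrow> s = Lower then Unlooped else Looped)" for p c
  have edge: "e p \<in> edges poset_graph" for p
    by (simp add: e_def poset_graph_edge_iff)
  have restrict: "restrict (hom_of a) (e p) = \<psi> p (p \<in> f a)" for a p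
  proof (rule ext)
    show "restrict (hom_of a) (e p) x = \<psi> p (p \<in> f a) x" for x
      by (cases x) (auto simp: \<psi>_def e_def hom_of_eq)
  qed
  have \<psi>_eq: "\<psi> p c = \<psi> p d \<longleftrightarrow> c = d" for p c d
  proof
    assume "\<psi> p c = \<psi> p d"
    then have "\<psi> p c (p, Lower) = \<psi> p d (p, Lower)"
      by simp
    then show "c = d"
      by (simp add: \<psi>_def e_def split: if_splits)
  qed simp
  have mult: "size {#a \<in># M. (p \<in> f a) = c#} = size {#a \<in># N. (p \<in> f a) = c#}" for p c
  proof -
    have "size {#a \<in># K. (p \<in> f a) = c#} =
      Poly_Mapping.lookup (\<Sum>a\<in>#K. exponent a) (e p, \<psi> p c)" for K
      unfolding lookup_exponent_sum[OF edge] restrict \<psi>_eq ..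
    then show ?thesis
      using assms by simp
  qed
  show "multiplicity_at p M = multiplicity_at p N"
    using mult[of p True] by (simp add: multiplicity_at_def)
  \<comment> \<open>Every variable has one of the two restrictions on a single matching edge, so the
    two counts add up to the degree.\<close>
  have size_split: "size K = size {#a \<in># K. (p \<in> f a) = True#} +
    size {#a \<in># K. (p \<in> f a) = False#}" for K
    by (induction K) auto
  show "size M = size N"
    unfolding size_split[of M] size_split[of N] mult ..
qed

text \<open>On the edge \<open>{(p, l), (q, u)}\<close> with \<open>q \<le> p\<close> a lower ideal restricts to one of
  \<open>{}\<close>, \<open>{q}\<close>, \<open>{p, q}\<close>. As these form a chain, join and meet permute the two restrictions.\<close>

lemma Phi_hom_hibi_relation:
  "Phi_hom poset_graph (pvar (hom_of a)) * Phi_hom poset_graph (pvar (hom_of b)) =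
    (Phi_hom poset_graph (pvar (hom_of (sup a b))) * Phi_hom poset_graph (pvar (hom_of (inf a b)))
      :: (_, 'k::field) mpoly)"
  unfolding Phi_hom_def poly_subst_pvar prod.distrib[symmetric]
proof (rule prod.cong[OF refl])
  fix e :: "('p \<times> side) set" assume "e \<in> edges poset_graph"
  then obtain p q where e: "e = {(p, Lower), (q, Upper)}" and "q \<le> p"
    by (auto simp: poset_graph_def)
  \<comment> \<open>On this edge a homomorphism sees only the membership of p and q, so the claim
    becomes a case distinction on these.\<close>
  have eq: "restrict (hom_of c) e = restrict (hom_of d) e"
    if "p \<in> f c \<longleftrightarrow> p \<in> f d" "q \<in> f c \<longleftrightarrow> q \<in> f d" for c d
    using that by (auto simp: e hom_of_eq restrict_def fun_eq_iff)
  have "restrict (hom_of (sup a b)) e = restrict (hom_of b) e \<and>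
      restrict (hom_of (inf a b)) e = restrict (hom_of a) e \<or>
    restrict (hom_of (sup a b)) e = restrict (hom_of a) e \<and>
      restrict (hom_of (inf a b)) e = restrict (hom_of b) e"
    using lower[OF \<open>q \<le> p\<close>, of a] lower[OF \<open>q \<le> p\<close>, of b]
      eq[of "sup a b" b] eq[of "inf a b" a] eq[of "sup a b" a] eq[of "inf a b" b]
    unfolding f_sup f_inf by blast
  then show "pvar (e, restrict (hom_of a) e) * pvar (e, restrict (hom_of b) e) =
    (pvar (e, restrict (hom_of (sup a b)) e) * pvar (e, restrict (hom_of (inf a b)) e)
      :: (_, 'k) mpoly)"
    by (auto simp: mult.commute)
qed

section \<open>Hibi's ideal as a kernel and the isomorphism of quotients\<close>

definition rename :: "('d, 'k::field) mpoly \<Rightarrow> ('p \<times> side \<Rightarrow> lambda_vertex, 'k) mpoly"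
  where "rename = poly_subst (\<lambda>a. pvar (hom_of a))"

lemma rename_ring_hom: "ring_hom_ring (poly_algebra UNIV) (poly_algebra (range hom_of)) rename"
  unfolding rename_def by (rule poly_subst_ring_hom) (simp only: pvar_carrier_iff rangeI)

lemma rename_surj:
  "rename ` carrier (poly_algebra UNIV) =
    carrier (poly_algebra (range hom_of) :: ('k::field, (_, 'k) mpoly) k_algebra)"
proof
  show "rename ` carrier (poly_algebra UNIV) \<subseteq>
    carrier (poly_algebra (range hom_of) :: ('k, (_, 'k) mpoly) k_algebra)"
    using ring_hom_closed[OF ring_hom_ring.homh[OF rename_ring_hom]] by blast
  show "carrier (poly_algebra (range hom_of) :: ('k, (_, 'k) mpoly) k_algebra)
    \<subseteq> rename ` carrier (poly_algebra UNIV)"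
  proof
    fix p :: "('p \<times> side \<Rightarrow> lambda_vertex, 'k) mpoly"
    assume p: "p \<in> carrier (poly_algebra (range hom_of))"
    \<comment> \<open>The preimage replaces each variable by a chosen lattice element mapping to it.
      The choice is arbitrary off the range of \<open>hom_of\<close>, where \<open>p\<close> has no
      variables.\<close>
    have "rename (poly_subst (\<lambda>\<phi>. pvar (inv_into UNIV hom_of \<phi>)) p) =
      poly_subst (\<lambda>\<phi>. pvar (hom_of (inv_into UNIV hom_of \<phi>))) p"
      by (simp add: rename_def poly_subst_poly_subst)
    also have "\<dots> = poly_subst pvar p"
    proof (rule poly_subst_cong)
      fix m \<phi> assume "m \<in> Poly_Mapping.keys p" "\<phi> \<in> Poly_Mapping.keys m"
      then have "\<phi> \<in> range hom_of"
        using p by auto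
      then show "pvar (hom_of (inv_into UNIV hom_of \<phi>)) = pvar \<phi>"
        by (simp add: f_inv_into_f)
    qed
    finally have "p = rename (poly_subst (\<lambda>\<phi>. pvar (inv_into UNIV hom_of \<phi>)) p)"
      by simp
    then show "p \<in> rename ` carrier (poly_algebra UNIV)"
      by (rule image_eqI) simp
  qed
qed

lemma Phi_hom_rename:
  "Phi_hom poset_graph (rename p) = poly_subst (\<lambda>a. Poly_Mapping.single (exponent a) 1) p"
  by (simp add: rename_def poly_subst_poly_subst Phi_hom_def flip: Phi_hom_pvar)

text \<open>The kernel is an ideal containing the generators, which gives one inclusion. Conversely,
  \<open>monomial_map_kernel_subset\<close> reduces to binomials, and equal images force equal
  degrees and multiplicities.\<close>

theorem hibi_ideal_eq_kernel:
  "hibi_ideal = {p :: ('d, 'k::field) mpoly. Phi_hom poset_graph (rename p) = 0}"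
proof
  let ?\<Psi> = "poly_subst (\<lambda>a. Poly_Mapping.single (exponent a) (1::'k))"
  have hom: "ring_hom_ring (poly_algebra UNIV) (poly_algebra UNIV) ?\<Psi>"
    by (rule poly_subst_ring_hom) simp
  have kernel: "a_kernel (poly_algebra UNIV) (poly_algebra UNIV) ?\<Psi> =
    {p. Phi_hom poset_graph (rename p) = 0}"
    by (simp add: a_kernel_def' Phi_hom_rename)
  have "{pvar a * pvar b - pvar (sup a b) * pvar (inf a b) | a b. True}
    \<subseteq> {p. Phi_hom poset_graph (rename p) = 0}"
    using Phi_hom_hibi_relation
    by (auto simp: Phi_hom_rename poly_subst_diff poly_subst_mult Phi_hom_pvar)
  then show "hibi_ideal \<subseteq> {p :: ('d, 'k) mpoly. Phi_hom poset_graph (rename p) = 0}"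
    unfolding hibi_ideal_def
    using ring.genideal_minimal[OF ring_poly_algebra ring_hom_ring.kernel_is_ideal[OF hom]]
    unfolding kernel by blast
  show "{p :: ('d, 'k) mpoly. Phi_hom poset_graph (rename p) = 0} \<subseteq> hibi_ideal"
  proof
    fix p :: "('d, 'k) mpoly"
    assume "p \<in> {p. Phi_hom poset_graph (rename p) = 0}"
    then have "?\<Psi> p = 0"
      by (simp add: Phi_hom_rename)
    then show "p \<in> hibi_ideal"
      by (rule monomial_map_kernel_subset[OF ideal_hibi_ideal, rotated])
        (intro monomial_diff_in_hibi_ideal size_multiplicity_at_of_exponent)
  qed
qed

lemma hom_of_graph_hom: "hom_of a \<in> graph_hom poset_graph Lambda"
proof -
  have "f a \<in> lower_ideals"
    using range by blast
  then show ?thesis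
    unfolding hom_of_def
    using bij_betw_hom_of_indep independent_indep_of_ideal by (metis bij_betwE mem_Collect_eq)
qed

text \<open>The variables of the top part are among those of the full ring, so intersecting with the
  subalgebra restricts the kernel. Enlarging the target to all variables changes no kernel, as the
  zero stays the same.\<close>

lemma I_top_poset_graph:
  "I_top poset_graph = a_kernel (poly_algebra (range hom_of)) (poly_algebra UNIV)
    (Phi_hom poset_graph :: (_, 'k::field) mpoly \<Rightarrow> _)"
  using hom_of_graph_hom
  by (auto simp: I_top_def I_hom_def R_top_poset_graph R_hom_def S_hom_def a_kernel_def')

text \<open>First isomorphism theorem for \<open>rename\<close> followed by the quotient map, which
  is onto and has Hibi's ideal as kernel.\<close>

theorem hibi_algebra_isomorphic:
  "k_algebra_isomorphic (hibi_algebra :: ('k::field, ('d, 'k) mpoly set) k_algebra)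
    (quotient_algebra (R_top (poset_graph :: ('p \<times> side) graph)) (I_top poset_graph))"
proof -
  let ?A = "poly_algebra UNIV :: ('k, ('d, 'k) mpoly) k_algebra"
  let ?R = "poly_algebra (range hom_of)
    :: ('k, ('p \<times> side \<Rightarrow> lambda_vertex, 'k) mpoly) k_algebra"
  let ?I = "I_top poset_graph :: ('p \<times> side \<Rightarrow> lambda_vertex, 'k) mpoly set"
  let ?h = "\<lambda>p. ?I +>\<^bsub>?R\<^esub> rename p"
  have ideal: "ideal ?I ?R"
    unfolding I_top_poset_graph
    by (intro ring_hom_ring.kernel_is_ideal) (simp add: Phi_hom_def poly_subst_ring_hom)
  have hom: "ring_hom_ring ?A (?R Quot ?I) ?h"
    using ring_hom_trans[OF ring_hom_ring.homh[OF rename_ring_hom] ideal.rcos_ring_hom[OF ideal]]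
    by (intro ring_hom_ringI2 ring_poly_algebra ideal.quotient_is_ring[OF ideal])
      (simp add: o_def)
  have surj: "?h ` carrier ?A = carrier (?R Quot ?I)"
    unfolding FactRing_def A_RCOSETS_def' rename_surj[symmetric] by auto
  have "p \<in> a_kernel ?A (?R Quot ?I) ?h \<longleftrightarrow> Phi_hom poset_graph (rename p) = 0" for p
  proof -
    have carrier: "rename p \<in> carrier ?R"
      using ring_hom_closed[OF ring_hom_ring.homh[OF rename_ring_hom], of p] by simp
    have "p \<in> a_kernel ?A (?R Quot ?I) ?h \<longleftrightarrow> ?h p = ?I"
      by (simp add: a_kernel_def' FactRing_def)
    also have "\<dots> \<longleftrightarrow> rename p \<in> ?I"
      using ideal.rcos_const_imp_mem[OF ideal carrier] ring.a_rcos_zero[OF ring_poly_algebra ideal]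
      by blast
    also have "\<dots> \<longleftrightarrow> Phi_hom poset_graph (rename p) = 0"
      using carrier by (simp add: I_top_poset_graph a_kernel_def')
    finally show ?thesis .
  qed
  then have kernel: "a_kernel ?A (?R Quot ?I) ?h = hibi_ideal"
    unfolding hibi_ideal_eq_kernel by blast
  \<comment> \<open>The induced map on quotients: \<open>?h\<close> is constant on each coset of its
    kernel, and \<open>the_elem\<close> extracts that value.\<close>
  let ?g = "\<lambda>X. the_elem (?h ` X)"
  have iso: "?g \<in> ring_iso (?A Quot hibi_ideal) (?R Quot ?I)"
    using ring_hom_ring.FactRing_iso_set[OF hom surj] unfolding kernel .
  \<comment> \<open>Since \<open>rename\<close> fixes constants, the ring isomorphism respects the
    structure maps.\<close>
  have const: "?g (hibi_ideal +>\<^bsub>?A\<^esub> pconst c) = ?I +>\<^bsub>?R\<^esub> pconst c" for c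
    using ring_hom_ring.the_elem_simp[OF hom pconst_carrier] unfolding kernel
    by (simp add: rename_def)
  show ?thesis
    unfolding k_algebra_isomorphic_def
  proof (intro bexI allI)
    show "?g (structure_map hibi_algebra c) =
      structure_map (quotient_algebra (R_top poset_graph) ?I) c" for c
      using const by (simp add: hibi_algebra_def quotient_algebra_def R_top_poset_graph
          ring.defs k_algebra.defs)
    show "?g \<in> ring_iso hibi_algebra (quotient_algebra (R_top poset_graph) ?I)"
      using iso by (simp add: hibi_algebra_def quotient_algebra_def R_top_poset_graph
          ring.defs k_algebra.defs ring_iso_def ring_hom_def)
  qed
qed

end

theorem theorem10p2:
  fixes f :: "'d::distrib_lattice \<Rightarrow> 'p::{finite, order} set"
  assumes "bij_betw f UNIV lower_ideals"
    and "\<And>a b. a \<le> b \<longleftrightarrow> f a \<subseteq> f b"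
  shows "k_algebra_isomorphic
    (hibi_algebra :: ('k::field, ('d, 'k) mpoly set) k_algebra)
    (quotient_algebra (R_top (poset_graph :: ('p \<times> side) graph)) (I_top poset_graph))"
proof -
  interpret lower_ideal_lattice f
    by standard (fact assms)+
  show ?thesis
    by (rule hibi_algebra_isomorphic)
qed

end
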